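(* Let $\mathcal{C}$ be a discrete set of tasks with a target task $c_{\mathrm{targ}}\in\mathcal{C}$. For each $c\in\mathcal{C}$ let $\mathcal{M}_c$ be a contextual MDP with singleton state space $\mathcal{S}=\{s\}$ and action space $\mathcal{A}=\{a_1,a_2\}$, in which any action taken from the initial state $s$ leads to a terminal state. For each $c \in \mathcal{C}$, let $a_c^{\mathrm{opt}}$ and $a_c^{\mathrm{non}}$ denote the optimal and non-optimal actions (so $\{a_c^{\mathrm{opt}},a_c^{\mathrm{non}}\}=\mathcal{A}$), with rewards $R_c(s,a_c^{\mathrm{opt}})=1$ and $R_c(s,a_c^{\mathrm{non}})=0$. Let $\phi:\mathcal{S}\times\mathcal{C}\times\mathcal{A}\to\mathbb{R}^d$ be a feature map, and for $\theta\in\mathbb{R}^d$ let $$\pi_\theta(a\mid s,c) = \frac{\exp(\langle\theta,\phi(s,c,a)\rangle)}{\sum_{a'\in\mathcal{A}}\exp(\langle\theta,\phi(s,c,a')\rangle)}.$$ Define $\psi(c) := \phi(s,c,a_c^{\mathrm{opt}})-\phi(s,c,a_c^{\mathrm{non}})$. Let $\theta_t\in\mathbb{R}^d$ be the policy parameter of the REINFORCE agent at step $t$, and set $$g_t(c) := \left[\nabla_\theta V^{\pi_\theta}(c)\right]_{\theta=\theta_t}, \qquad Z_t(c) := \frac{V^{\pi_{\theta_t}}(c)}{V^*(c)}\left(V^*(c)-V^{\pi_{\theta_t}}(c)\right).$$ Then for every $c\in\mathcal{C}$, $$\left\langle g_t(c), g_t(c_{\mathrm{targ}})\right\rangle = Z_t(c)\cdot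 Z_t(c_{\mathrm{targ}})\cdot\left\langle\psi(c),\psi(c_{\mathrm{targ}})\right\rangle.$$
   Context: For a contextual policy $\pi$ (a map assigning to each state and task a probability distribution over actions), $V^\pi(c)$ denotes the expected discounted cumulative reward of $\pi$ in $\mathcal{M}_c$; in the present one-step setting this is $V^\pi(c)=\sum_{a\in\mathcal{A}}\pi(a\mid s,c)R_c(s,a)$. Also $V^*(c):=\max_\pi V^\pi(c)$, the maximum over all contextual policies. $\langle\cdot,\cdot\rangle$ is the Euclidean inner product on $\mathbb{R}^d$. *)

theory Defs
  imports "HOL-Probability.Probability"
begin

text \<open>
  A contextual MDP with states \<open>'s\<close>, actions \<open>'a\<close> and tasks (contexts) \<open>'c\<close>.
  The type \<open>'s\<close> holds the non-terminal states only; a transition to a terminal state is a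
  transition to \<open>None\<close>, which is absorbing and yields no further reward.
\<close>

record ('s, 'a, 'c) cmdp =
  discount :: real
  init_dist :: "'c \<Rightarrow> 's pmf"
  trans_dist :: "'c \<Rightarrow> 's \<Rightarrow> 'a \<Rightarrow> 's option pmf"
  reward :: "'c \<Rightarrow> 's \<Rightarrow> 'a \<Rightarrow> real"

type_synonym ('s, 'a, 'c) policy = "'s \<Rightarrow> 'c \<Rightarrow> 'a pmf"

primrec state_dist ::
  "('s, 'a, 'c) cmdp \<Rightarrow> ('s, 'a, 'c) policy \<Rightarrow> 'c \<Rightarrow> nat \<Rightarrow> 's option pmf" where
  "state_dist M \<pi> c 0 = map_pmf Some (init_dist M c)"
| "state_dist M \<pi> c (Suc n) =
     bind_pmf (state_dist M \<pi> c n)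
       (\<lambda>x. case x of
              None \<Rightarrow> return_pmf None
            | Some s \<Rightarrow> bind_pmf (\<pi> s c) (trans_dist M c s))"

definition expected_reward ::
  "('s, 'a, 'c) cmdp \<Rightarrow> ('s, 'a, 'c) policy \<Rightarrow> 'c \<Rightarrow> nat \<Rightarrow> real" where
  "expected_reward M \<pi> c n =
     measure_pmf.expectation (state_dist M \<pi> c n)
       (\<lambda>x. case x of
              None \<Rightarrow> 0
            | Some s \<Rightarrow> measure_pmf.expectation (\<pi> s c) (reward M c s))"

definition policy_value ::
  "('s, 'a, 'c) cmdp \<Rightarrow> ('s, 'a, 'c) policy \<Rightarrow> 'c \<Rightarrow> real" where
  "policy_value M \<pi> c = (\<Sum>n. discount M ^ n * expected_reward M \<pi> c n)"

text \<open>The maximum over all contextual policies (not merely the supremum).\<close>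

definition optimal_value :: "('s, 'a, 'c) cmdp \<Rightarrow> 'c \<Rightarrow> real" where
  "optimal_value M c = (GREATEST v. \<exists>\<pi>. v = policy_value M \<pi> c)"

definition softmax_policy ::
  "('s \<Rightarrow> 'c \<Rightarrow> 'a::finite \<Rightarrow> real ^ 'd) \<Rightarrow> real ^ 'd \<Rightarrow> ('s, 'a, 'c) policy" where
  "softmax_policy \<phi> \<theta> s c =
     embed_pmf (\<lambda>a. exp (\<theta> \<bullet> \<phi> s c a) / (\<Sum>a'\<in>UNIV. exp (\<theta> \<bullet> \<phi> s c a')))"

definition gradient :: "('v::real_inner \<Rightarrow> real) \<Rightarrow> 'v \<Rightarrow> 'v" where
  "gradient f x = (THE D. GDERIV f x :> D)"

definition value_gradient ::
  "('s, 'a::finite, 'c) cmdp \<Rightarrow> ('s \<Rightarrow> 'c \<Rightarrow> 'a \<Rightarrow> real ^ 'd) \<Rightarrow> real ^ 'd \<Rightarrow> 'c \<Rightarrow> real ^ 'd" where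
  "value_gradient M \<phi> \<theta> c = gradient (\<lambda>\<theta>'. policy_value M (softmax_policy \<phi> \<theta>') c) \<theta>"

definition value_factor ::
  "('s, 'a, 'c) cmdp \<Rightarrow> ('s, 'a, 'c) policy \<Rightarrow> 'c \<Rightarrow> real" where
  "value_factor M \<pi> c =
     policy_value M \<pi> c / optimal_value M c * (optimal_value M c - policy_value M \<pi> c)"

definition feature_gap ::
  "('s \<Rightarrow> 'c \<Rightarrow> 'a \<Rightarrow> real ^ 'd) \<Rightarrow> 's \<Rightarrow> ('c \<Rightarrow> 'a) \<Rightarrow> ('c \<Rightarrow> 'a) \<Rightarrow> 'c \<Rightarrow> real ^ 'd" where
  "feature_gap \<phi> s a_opt a_non c = \<phi> s c (a_opt c) - \<phi> s c (a_non c)"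

text \<open>The argument of \<open>embed_pmf\<close> above is a probability mass function.\<close>

lemma pmf_softmax_policy:
  "pmf (softmax_policy \<phi> \<theta> s c) a =
     exp (\<theta> \<bullet> \<phi> s c a) / (\<Sum>a'\<in>UNIV. exp (\<theta> \<bullet> \<phi> s c a'))"
proof -
  have pos: "(\<Sum>a'\<in>UNIV. exp (\<theta> \<bullet> \<phi> s c a')) > 0"
    by (intro sum_pos) auto
  show ?thesis
    unfolding softmax_policy_def
  proof (rule pmf_embed_pmf)
    show "0 \<le> exp (\<theta> \<bullet> \<phi> s c a) / (\<Sum>a'\<in>UNIV. exp (\<theta> \<bullet> \<phi> s c a'))" for a
      using pos by simp
    show "(\<integral>\<^sup>+ a. ennreal (exp (\<theta> \<bullet> \<phi> s c a) / (\<Sum>a'\<in>UNIV. exp (\<theta> \<bullet> \<phi> s c a')))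
            \<partial>count_space UNIV) = 1"
      using pos
      by (simp add: nn_integral_count_space_finite sum_ennreal less_imp_le
          flip: sum_divide_distrib)
  qed
qed

text \<open>
  If the process starts in \<open>s\<close> and every action there terminates, then the discounted return
  reduces to the expected immediate reward.
\<close>

lemma policy_value_one_step:
  fixes M :: "('s, 'a::finite, 'c) cmdp"
  assumes init: "init_dist M c = return_pmf s"
    and "\<And>a. trans_dist M c s a = return_pmf None"
  shows "policy_value M \<pi> c = (\<Sum>a\<in>UNIV. pmf (\<pi> s c) a * reward M c s a)"
proof -
  have terminal: "trans_dist M c s = (\<lambda>_. return_pmf None)"
    using assms by auto
  have dist: "state_dist M \<pi> c (Suc n) = return_pmf None" for n
    by (induction n) (simp_all add: init terminal bind_return_pmf)
  have zero: "expected_reward M \<pi> c n = 0" if "n \<noteq> 0" for n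
    using that dist by (cases n) (simp_all add: expected_reward_def del: state_dist.simps)
  have "policy_value M \<pi> c = (\<Sum>n\<in>{0}. discount M ^ n * expected_reward M \<pi> c n)"
    unfolding policy_value_def by (rule suminf_finite) (auto simp: zero)
  also have "\<dots> = measure_pmf.expectation (\<pi> s c) (reward M c s)"
    by (simp add: expected_reward_def init)
  also have "\<dots> = (\<Sum>a\<in>UNIV. pmf (\<pi> s c) a * reward M c s a)"
    by (subst integral_measure_pmf[of UNIV]) auto
  finally show ?thesis .
qed

end

theory Submission
  imports Defs
begin

text \<open>
  The softmax value of a task with action rewards \<open>1\<close> and \<open>0\<close> is the logistic sigmoid
  \<open>\<sigma>\<close> of \<open>\<langle>\<theta>, \<psi>(c)\<rangle>\<close>. Since \<open>\<sigma>' = \<sigma> (1 - \<sigma>)\<close> and the optimal value is \<open>1\<close>,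
  the gradient is \<open>Z(c) \<psi>(c)\<close>; the claim is the bilinearity of the inner product.
\<close>

text \<open>\<open>gradient\<close> is a definite description, so exhibiting a derivative is not
  enough: uniqueness must be supplied as well. It comes from uniqueness of the Frechet
  derivative.\<close>

lemma gradient_eqI:
  assumes "GDERIV f x :> D"
  shows "gradient f x = D"
  unfolding gradient_def
proof (rule the_equality, rule assms)
  fix E assume "GDERIV f x :> E"
  then have "(\<lambda>h. h \<bullet> E) = (\<lambda>h. h \<bullet> D)"
    using assms unfolding gderiv_def by (rule has_derivative_unique)
  then have "h \<bullet> E = h \<bullet> D" for h
    by (rule fun_cong)
  \<comment> \<open>A vector is determined by its inner products with all vectors.\<close>
  then show "E = D"
    using vector_eq_ldot[of E D] by simp
qed

lemma GDERIV_sigmoid_inner: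
  fixes \<psi> \<theta> :: "'v::real_inner"
  defines "\<sigma> \<equiv> \<lambda>\<theta>. 1 / (1 + exp (- (\<theta> \<bullet> \<psi>)))"
  shows "GDERIV \<sigma> \<theta> :> (\<sigma> \<theta> * (1 - \<sigma> \<theta>)) *\<^sub>R \<psi>"
proof -
  define f :: "real \<Rightarrow> real" where "f \<equiv> \<lambda>x. 1 / (1 + exp (- x))"
  have pos: "1 + exp (- x) > 0" for x :: real
    by (simp add: add_pos_pos)
  have "DERIV f x :> exp (- x) / (1 + exp (- x))\<^sup>2" for x
    unfolding f_def using pos[of x]
    by (auto intro!: derivative_eq_intros simp: power2_eq_square)
  \<comment> \<open>Here \<open>1 - f x\<close> equals
    \<open>exp (- x) / (1 + exp (- x))\<close>.\<close>
  moreover have "exp (- x) / (1 + exp (- x))\<^sup>2 = f x * (1 - f x)" for x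
    unfolding f_def using pos[of x] by (simp add: field_simps power2_eq_square)
  ultimately have "DERIV f (\<theta> \<bullet> \<psi>) :> f (\<theta> \<bullet> \<psi>) * (1 - f (\<theta> \<bullet> \<psi>))"
    by simp
  moreover have "GDERIV (\<lambda>\<theta>. \<theta> \<bullet> \<psi>) \<theta> :> \<psi>"
    unfolding gderiv_def by (auto intro!: derivative_eq_intros)
  ultimately show ?thesis
    unfolding \<sigma>_def f_def by (rule GDERIV_DERIV_compose[rotated])
qed

lemma policy_value_two_actions:
  fixes M :: "('s, 'a::finite, 'c) cmdp"
  assumes "init_dist M c = return_pmf s" "\<And>a. trans_dist M c s a = return_pmf None"
    and "UNIV = {opt, non}" "reward M c s opt = 1" "reward M c s non = 0"
  shows "policy_value M \<pi> c = pmf (\<pi> s c) opt"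
proof -
  \<comment> \<open>The rewards 1 and 0 differ; distinctness keeps the sum over
    \<open>{opt, non}\<close> from collapsing to one term.\<close>
  have "opt \<noteq> non"
    using assms(4,5) by auto
  then have "(\<Sum>a\<in>{opt, non}. pmf (\<pi> s c) a * reward M c s a) = pmf (\<pi> s c) opt"
    using assms(4,5) by simp
  then show ?thesis
    using policy_value_one_step[OF assms(1,2)] assms(3) by simp
qed

text \<open>The value of a policy is its probability of \<open>opt\<close>, hence at most 1.
  \<open>GREATEST\<close> also needs attainment, which the deterministic policy choosing
  \<open>opt\<close> provides.\<close>

lemma optimal_value_two_actions:
  fixes M :: "('s, 'a::finite, 'c) cmdp"
  assumes "init_dist M c = return_pmf s" "\<And>a. trans_dist M c s a = return_pmf None"
    and "UNIV = {opt, non}" "reward M c s opt = 1" "reward M c s non = 0"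
  shows "optimal_value M c = 1"
  unfolding optimal_value_def policy_value_two_actions[where M = M and c = c, OF assms]
proof (rule Greatest_equality)
  show "\<exists>\<pi>. 1 = pmf ((\<pi> :: ('s, 'a, 'c) policy) s c) opt"
    by (rule exI[of _ "\<lambda>_ _. return_pmf opt"]) simp
qed (auto simp: pmf_le_1)

lemma pmf_softmax_two_actions:
  fixes \<phi> :: "'s \<Rightarrow> 'c \<Rightarrow> 'a::finite \<Rightarrow> real ^ 'd"
  assumes "UNIV = {opt, non}" "opt \<noteq> non"
  shows "pmf (softmax_policy \<phi> \<theta> s c) opt =
    1 / (1 + exp (- (\<theta> \<bullet> (\<phi> s c opt - \<phi> s c non))))"
proof -
  have "(\<Sum>a\<in>UNIV. exp (\<theta> \<bullet> \<phi> s c a)) = exp (\<theta> \<bullet> \<phi> s c opt) + exp (\<theta> \<bullet> \<phi> s c non)"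
    unfolding assms(1) using assms(2) by simp
  \<comment> \<open>The factor pulled out is the softmax numerator of \<open>opt\<close>, so it
    cancels and leaves the sigmoid.\<close>
  also have "\<dots> = exp (\<theta> \<bullet> \<phi> s c opt) * (1 + exp (- (\<theta> \<bullet> (\<phi> s c opt - \<phi> s c non))))"
    by (simp add: distrib_left inner_diff_right flip: exp_add)
  finally show ?thesis
    by (simp add: pmf_softmax_policy)
qed

lemma value_gradient_two_actions:
  fixes M :: "('s, 'a::finite, 'c) cmdp" and \<phi> :: "'s \<Rightarrow> 'c \<Rightarrow> 'a \<Rightarrow> real ^ 'd"
  assumes mdp: "init_dist M c = return_pmf s" "\<And>a. trans_dist M c s a = return_pmf None"
    "UNIV = {a_opt c, a_non c}" "reward M c s (a_opt c) = 1" "reward M c s (a_non c) = 0"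
  shows "value_gradient M \<phi> \<theta> c =
    value_factor M (softmax_policy \<phi> \<theta>) c *\<^sub>R feature_gap \<phi> s a_opt a_non c"
proof -
  have "a_opt c \<noteq> a_non c"
    using mdp(4,5) by auto
  note softmax = pmf_softmax_two_actions[OF mdp(3) this, of \<phi> _ s c]
  \<comment> \<open>Stated for every \<theta>', so that it rewrites the function being
    differentiated and not only its value at \<theta>.\<close>
  have val: "policy_value M (softmax_policy \<phi> \<theta>') c =
      1 / (1 + exp (- (\<theta>' \<bullet> feature_gap \<phi> s a_opt a_non c)))" for \<theta>'
    by (simp only: policy_value_two_actions[where M = M and c = c, OF mdp] softmax
        feature_gap_def)
  show ?thesis
    \<comment> \<open>With optimal value 1, \<open>value_factor\<close> becomes \<sigma> * (1 -
      \<sigma>), exactly the coefficient in the sigmoid gradient.\<close>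
    unfolding value_gradient_def value_factor_def val
      optimal_value_two_actions[where M = M and c = c, OF mdp] div_by_1
    by (rule gradient_eqI[OF GDERIV_sigmoid_inner])
qed

theorem proposition1:
  fixes M :: "('s, 'a::finite, 'c) cmdp"
    and C :: "'c set" and c_targ :: 'c
    and s :: 's and a1 a2 :: 'a
    and a_opt a_non :: "'c \<Rightarrow> 'a"
    and \<phi> :: "'s \<Rightarrow> 'c \<Rightarrow> 'a \<Rightarrow> real ^ 'd"
    and \<theta> :: "nat \<Rightarrow> real ^ 'd" and t :: nat
  assumes "c_targ \<in> C"
    and "(UNIV :: 's set) = {s}"
    and "(UNIV :: 'a set) = {a1, a2}"
    and "\<And>c. c \<in> C \<Longrightarrow> init_dist M c = return_pmf s"
    and "\<And>c a. c \<in> C \<Longrightarrow> trans_dist M c s a = return_pmf None"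
    and "\<And>c. c \<in> C \<Longrightarrow> {a_opt c, a_non c} = {a1, a2}"
    and "\<And>c. c \<in> C \<Longrightarrow> reward M c s (a_opt c) = 1"
    and "\<And>c. c \<in> C \<Longrightarrow> reward M c s (a_non c) = 0"
  shows "\<forall>c\<in>C. value_gradient M \<phi> (\<theta> t) c \<bullet> value_gradient M \<phi> (\<theta> t) c_targ =
    value_factor M (softmax_policy \<phi> (\<theta> t)) c
      * value_factor M (softmax_policy \<phi> (\<theta> t)) c_targ
      * (feature_gap \<phi> s a_opt a_non c \<bullet> feature_gap \<phi> s a_opt a_non c_targ)"
proof
  fix c assume "c \<in> C"
  \<comment> \<open>Proved for an arbitrary task of \<open>C\<close>, since it is applied both to
    the fixed task and to \<open>c_targ\<close>.\<close>
  have grad: "value_gradient M \<phi> (\<theta> t) c =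
      value_factor M (softmax_policy \<phi> (\<theta> t)) c *\<^sub>R feature_gap \<phi> s a_opt a_non c"
    if "c \<in> C" for c
  proof (rule value_gradient_two_actions)
    show "UNIV = {a_opt c, a_non c}"
      using assms(3) assms(6)[OF that] by (rule trans[OF _ sym])
  qed (fact assms(4,5,7,8)[OF that])+
  show "value_gradient M \<phi> (\<theta> t) c \<bullet> value_gradient M \<phi> (\<theta> t) c_targ =
    value_factor M (softmax_policy \<phi> (\<theta> t)) c
      * value_factor M (softmax_policy \<phi> (\<theta> t)) c_targ
      * (feature_gap \<phi> s a_opt a_non c \<bullet> feature_gap \<phi> s a_opt a_non c_targ)"
    by (simp add: grad[OF \<open>c \<in> C\<close>] grad[OF assms(1)])
qed

end
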